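(* For all integers $n,k\ge 1$, $$N_{n+k}(x)=\frac{1}{n!\,k!}\sum_{\pi\in\mathfrak{S}_n,\ \sigma\in\mathfrak{S}_k}B_\pi(x)\,B_\sigma(x)\,E_{\ell_\pi+\ell_\sigma}(x).$$
   Context: $\mathfrak{S}_n$ is the symmetric group on $\{1,\ldots,n\}$. The Narayana polynomial is $N_n(x)=\sum_{k=0}^{n-1}\frac1n\binom nk\binom n{k+1}x^k$. The Eulerian polynomial is $E_n(x)=\sum_{w\in\mathfrak{S}_n}x^{\operatorname{des}(w)}$, where $\operatorname{des}(w)=|\{i: w_i>w_{i+1}\}|$. The type B Narayana polynomial is $B_n(x)=\sum_{k=0}^{n-1}\binom{n-1}{k}^2x^k$. For a permutation $w$ with cycle type $(\lambda_1,\ldots,\lambda_\ell)$ (fixed points counted as cycles), $\ell_w=\ell$ is the number of cycles of $w$ and $B_w(x)=B_{\lambda_1}(x)\cdots B_{\lambda_\ell}(x)$. *)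

theory Defs
  imports "HOL-Computational_Algebra.Polynomial" "HOL-Combinatorics.Orbits" "HOL-Library.Multiset"
begin

definition sym_group :: "nat \<Rightarrow> (nat \<Rightarrow> nat) set" where
  "sym_group n = {w. w permutes {1..n}}"

definition narayana_poly :: "nat \<Rightarrow> rat poly" where
  "narayana_poly n = (\<Sum>k<n. monom (1 / of_nat n * of_nat (n choose k) * of_nat (n choose (k + 1))) k)"

definition des :: "nat \<Rightarrow> (nat \<Rightarrow> nat) \<Rightarrow> nat" where
  "des n w = card {i \<in> {1..<n}. w i > w (i + 1)}"

definition eulerian_poly :: "nat \<Rightarrow> rat poly" where
  "eulerian_poly n = (\<Sum>w\<in>sym_group n. monom 1 (des n w))"

definition narayana_B_poly :: "nat \<Rightarrow> rat poly" where
  "narayana_B_poly n = (\<Sum>k<n. monom (of_nat (((n - 1) choose k) ^ 2)) k)"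

text \<open>
  The cycles of a permutation \<open>w\<close> of \<open>{1..n}\<close> are identified with their supports, i.e. the orbits
  of \<open>w\<close> on \<open>{1..n}\<close>; a fixed point gives a singleton orbit, so it counts as a cycle of length 1.
  The cycle type is the multiset of the cycle lengths. The parameter \<open>n\<close> is needed because \<open>w\<close> is
  a function on all natural numbers, fixing everything outside \<open>{1..n}\<close>.
\<close>

definition perm_cycles :: "nat \<Rightarrow> (nat \<Rightarrow> nat) \<Rightarrow> nat set set" where
  "perm_cycles n w = orbit w ` {1..n}"

definition perm_cycle_type :: "nat \<Rightarrow> (nat \<Rightarrow> nat) \<Rightarrow> nat multiset" where
  "perm_cycle_type n w = image_mset card (mset_set (perm_cycles n w))"

definition num_cycles :: "nat \<Rightarrow> (nat \<Rightarrow> nat) \<Rightarrow> nat" where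
  "num_cycles n w = card (perm_cycles n w)"

definition narayana_B_perm_poly :: "nat \<Rightarrow> (nat \<Rightarrow> nat) \<Rightarrow> rat poly" where
  "narayana_B_perm_poly n w = prod_mset (image_mset narayana_B_poly (perm_cycle_type n w))"

end

theory Submission
  imports Defs "HOL-Computational_Algebra.Polynomial_FPS"
begin

text \<open>
  Fix a number $x \neq 1$. By the exponential formula,
  $P_n(y) = \frac{1}{n!} \sum_{\pi} B_\pi(x) y^{\ell_\pi}$ is the coefficient of $z^n$ in
  $\exp(y \sum_j B_j(x) z^j / j)$. Let $N$ be the series with $N = z (1 + N)(1 + x N)$. Lagrange
  inversion shows that its coefficients are the Narayana polynomials and that
  $P_n((1 - x) t)$ is the coefficient of $z^n$ in $G^t$, where $G = (1 + N) / (1 + x N)$.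

  Let $L$ be the linear functional with $L(y^m) = E_m(x)$. Since
  $E_m(x) = (1 - x)^{m+1} \sum_{t \ge 0} (t + 1)^m x^t$, it satisfies
  $L(f(y)) - x L(f(y + 1 - x)) = (1 - x) f(1 - x)$. Applied to $f = P_n P_k$ this gives
  $\Lambda(z, w) (1 - x G(z) G(w)) = (1 - x) G(z) G(w)$ for the generating function $\Lambda$ of the
  numbers $L(P_n P_k)$. Rational manipulation of $N$ shows that
  $\frac{z (1 + N(z)) - w (1 + N(w))}{z - w}$, the generating function of the Narayana polynomials
  indexed by $n + k$, solves the same equation. Hence the identity holds at every $x \neq 1$.
\<close>

unbundle fps_syntax

section \<open>Eulerian polynomials\<close>

text \<open>In one-line notation, the letter \<open>Suc m\<close> enters at position
  \<open>p\<close> and the later letters move one place to the right. The last branch keeps the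
  function the identity outside \<open>{1..Suc m}\<close>, as \<open>permutes\<close>
  demands.\<close>

definition insert_max :: "nat \<Rightarrow> nat \<Rightarrow> (nat \<Rightarrow> nat) \<Rightarrow> nat \<Rightarrow> nat" where
  "insert_max m p w i =
    (if i < p then w i else if i = p then Suc m else if i \<le> Suc m then w (i - 1) else i)"

lemma finite_sym_group [simp]: "finite (sym_group n)"
  unfolding sym_group_def by (rule finite_permutations) simp

lemma card_sym_group: "card (sym_group n) = fact n"
  unfolding sym_group_def by (rule card_permutations) auto

lemma insert_max_in_sym_group:
  assumes w: "w \<in> sym_group m" and p: "p \<in> {1..Suc m}"
  shows "insert_max m p w \<in> sym_group (Suc m)"
proof -
  have w': "w permutes {1..m}" using w by (simp add: sym_group_def)
  have r: "w i \<in> {1..m} \<longleftrightarrow> i \<in> {1..m}" for i using permutes_in_image[OF w'] .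
  have inj: "w i = w j \<longleftrightarrow> i = j" for i j
    using permutes_inj[OF w'] by (auto dest: injD)
  have o: "w i = i" if "i \<notin> {1..m}" for i using permutes_not_in[OF w' that] .
  have ne: "w i \<noteq> Suc m" if "i \<in> {1..m}" for i using r[of i] that by auto
  have "insert_max m p w permutes {1..Suc m}"
  proof (rule inj_imp_permutes)
    show "inj_on (insert_max m p w) {1..Suc m}"
    proof (rule inj_onI)
      fix i j assume ij: "i \<in> {1..Suc m}" "j \<in> {1..Suc m}" and e: "insert_max m p w i = insert_max m p w j"
      show "i = j"
      proof (cases "i = p \<or> j = p")
        case True
        have aux: "i' = p" if "i' \<in> {1..Suc m}" "insert_max m p w i' = Suc m" for i'
        proof (rule linorder_cases[of i' p])
          assume "i' < p"
          then show ?thesis using that p ne[of i'] by (auto simp: insert_max_def)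
        next
          assume "p < i'"
          moreover from this have "i' - 1 \<in> {1..m}" using that p by auto
          ultimately show ?thesis using that ne[of "i' - 1"] by (auto simp: insert_max_def)
        qed
        have "insert_max m p w p = Suc m" by (simp add: insert_max_def)
        then show ?thesis using True aux[OF ij(1)] aux[OF ij(2)] e by metis
      next
        case False
        then have v: "insert_max m p w k = w (if k < p then k else k - 1)" if "k \<in> {i, j}" for k
          using ij that by (auto simp: insert_max_def)
        have "(if i < p then i else i - 1) = (if j < p then j else j - 1)"
          using e v[of i] v[of j] inj by simp
        then show ?thesis using False by (auto split: if_splits)
      qed
    qed
  next
    fix i assume i: "i \<in> {1..Suc m}"
    show "insert_max m p w i \<in> {1..Suc m}"
      using i p r[of i] r[of "i - 1"] by (auto simp: insert_max_def)
  next
    fix i assume "i \<notin> {1..Suc m}"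
    then show "insert_max m p w i = i"
      using p o[of i] by (auto simp: insert_max_def)
  qed simp
  then show ?thesis by (simp add: sym_group_def)
qed

text \<open>The position of the letter \<open>Suc m\<close> recovers \<open>p\<close>, and deleting
  that letter recovers \<open>w\<close>.\<close>

lemma inj_on_insert_max:
  "inj_on (\<lambda>(w, p). insert_max m p w) (sym_group m \<times> {1..Suc m})"
proof (rule inj_onI, clarify)
  fix w p w' p'
  assume w: "w \<in> sym_group m" "w' \<in> sym_group m" and p: "p \<in> {1..Suc m}" "p' \<in> {1..Suc m}"
    and e: "insert_max m p w = insert_max m p' w'"
  have perm: "w permutes {1..m}" "w' permutes {1..m}" using w by (auto simp: sym_group_def)
  have "inj (insert_max m p' w')"
    using insert_max_in_sym_group[OF w(2) p(2)] by (auto simp: sym_group_def permutes_inj)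
  moreover have "insert_max m p' w' p = insert_max m p' w' p'"
    using fun_cong[OF e, of p] by (simp add: insert_max_def)
  ultimately have pp: "p = p'" by (rule injD)
  have "w i = w' i" for i
  proof -
    consider "i < p" | "p \<le> i" "i \<le> m" | "m < i" using p by fastforce
    then show ?thesis
    proof cases
      case 1
      then show ?thesis using fun_cong[OF e, of i] pp by (simp add: insert_max_def)
    next
      case 2
      then show ?thesis using fun_cong[OF e, of "Suc i"] pp by (simp add: insert_max_def)
    next
      case 3
      then show ?thesis using perm[THEN permutes_not_in, of i] by simp
    qed
  qed
  then show "w = w' \<and> p = p'" using pp by auto
qed

text \<open>Insertion is injective and (m+1) m! = (m+1)!, so it is a bijection; no inverse has to be
  written down.\<close>

lemma sum_sym_group_Suc:
  "(\<Sum>w\<in>sym_group (Suc m). f w) = (\<Sum>w\<in>sym_group m. \<Sum>p\<in>{1..Suc m}. f (insert_max m p w))"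
proof -
  let ?h = "\<lambda>(w, p). insert_max m p w"
  have "card (?h ` (sym_group m \<times> {1..Suc m})) = card (sym_group (Suc m))"
    by (subst card_image[OF inj_on_insert_max]) (simp add: card_cartesian_product card_sym_group)
  moreover have "?h ` (sym_group m \<times> {1..Suc m}) \<subseteq> sym_group (Suc m)"
    using insert_max_in_sym_group by auto
  ultimately have im: "?h ` (sym_group m \<times> {1..Suc m}) = sym_group (Suc m)"
    by (intro card_subset_eq) auto
  show ?thesis
    unfolding im[symmetric] sum.reindex[OF inj_on_insert_max] sum.cartesian_product
    by (simp add: case_prod_unfold o_def)
qed

text \<open>The new maximum is followed by a descent unless it comes last, and it is always preceded
  by an ascent. Splitting an old descent therefore trades one descent for another.\<close>

lemma des_insert_max:
  assumes w: "w \<in> sym_group m" and p: "p \<in> {1..Suc m}"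
  shows "des (Suc m) (insert_max m p w) =
    (if p = Suc m \<or> p - 1 \<in> {i \<in> {1..<m}. w i > w (i + 1)} then des m w else Suc (des m w))"
proof -
  define D where "D = {i \<in> {1..<m}. w i > w (i + 1)}"
  define D' where "D' = {i \<in> {1..<Suc m}. insert_max m p w i > insert_max m p w (i + 1)}"
  have w': "w permutes {1..m}" using w by (simp add: sym_group_def)
  have le: "w i \<le> m" if "i \<in> {1..m}" for i using permutes_in_image[OF w', of i] that by simp
  have fin: "finite D" by (simp add: D_def)
  \<comment> \<open>\<open>A\<close> holds the old descents that the insertion does not split;
    \<open>g\<close> gives their new positions.\<close>
  define A where "A = D - {p - 1}"
  define g where "g i = (if i < p then i else Suc i)" for i
  have D': "D' = g ` A \<union> (if p = Suc m then {} else {p})"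
  proof (rule set_eqI)
    fix i
    consider "i + 1 < p" | "i + 1 = p" | "i = p" | "p < i" by linarith
    then show "i \<in> D' \<longleftrightarrow> i \<in> g ` A \<union> (if p = Suc m then {} else {p})"
    proof cases
      case 1
      then have "i \<in> D' \<longleftrightarrow> i \<in> A" using p by (auto simp: D'_def D_def A_def insert_max_def)
      moreover have "i \<in> g ` A \<longleftrightarrow> i \<in> A" using 1 by (auto simp: g_def image_iff split: if_splits)
      ultimately show ?thesis using 1 by auto
    next
      case 2
      then have "i \<notin> D'" using p le[of i] by (auto simp: D'_def insert_max_def)
      moreover have "i \<notin> g ` A" using 2 by (auto simp: g_def A_def)
      ultimately show ?thesis using 2 by auto
    next
      case 3
      then have "i \<in> D' \<longleftrightarrow> p \<noteq> Suc m" using p le[of i] by (auto simp: D'_def insert_max_def)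
      moreover have "i \<notin> g ` A" using 3 by (auto simp: g_def A_def)
      ultimately show ?thesis using 3 by auto
    next
      case 4
      then have "i \<in> D' \<longleftrightarrow> i - 1 \<in> A"
        using p by (auto simp: D'_def D_def A_def insert_max_def)
      moreover have "i \<in> g ` A \<longleftrightarrow> i - 1 \<in> A"
      proof
        assume "i - 1 \<in> A"
        moreover have "g (i - 1) = i" using 4 by (simp add: g_def)
        ultimately show "i \<in> g ` A" by (metis imageI)
      qed (use 4 in \<open>auto simp: g_def split: if_splits\<close>)
      ultimately show ?thesis using 4 by auto
    qed
  qed
  have inj: "inj_on g A" by (auto simp: inj_on_def g_def split: if_splits)
  have notin: "p \<notin> g ` A" by (auto simp: g_def)
  have "card D' = card A + (if p = Suc m then 0 else 1)"
  proof -
    have "finite (g ` A)" using fin by (simp add: A_def)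
    then show ?thesis unfolding D' using notin card_image[OF inj] by simp
  qed
  moreover have "card A = (if p - 1 \<in> D then card D - 1 else card D)"
    using fin by (simp add: A_def card_Diff_singleton_if)
  moreover have "p - 1 \<in> D \<Longrightarrow> card D > 0" using fin by (auto simp: card_gt_0_iff)
  moreover have "p = Suc m \<Longrightarrow> p - 1 \<notin> D" by (simp add: D_def)
  ultimately have "card D' = (if p = Suc m \<or> p - 1 \<in> D then card D else Suc (card D))" by auto
  then show ?thesis by (simp only: des_def D_def D'_def)
qed

text \<open>Among the m+1 positions, the end and the \<open>des m w\<close> positions inside a
  descent keep the number of descents; the remaining ones raise it by one.\<close>

lemma sum_insert_max:
  fixes f :: "nat \<Rightarrow> rat poly"
  assumes w: "w \<in> sym_group m"
  shows "(\<Sum>p\<in>{1..Suc m}. f (des (Suc m) (insert_max m p w))) =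
    of_nat (Suc (des m w)) * f (des m w) + of_nat (m - des m w) * f (Suc (des m w))"
proof -
  define D where "D = {i \<in> {1..<m}. w i > w (i + 1)}"
  have fin: "finite D" and sub: "D \<subseteq> {1..<m}" by (auto simp: D_def)
  have d: "des m w = card D" by (simp add: des_def D_def)
  have inj: "inj_on Suc D" by simp
  have T: "Suc ` D \<subseteq> {1..m}" using sub by auto
  have "(\<Sum>p\<in>{1..m}. f (des (Suc m) (insert_max m p w))) =
     (\<Sum>p\<in>{1..m}. if p \<in> Suc ` D then f (card D) else f (Suc (card D)))"
  proof (rule sum.cong[OF refl])
    fix p assume p: "p \<in> {1..m}"
    then have "p \<in> Suc ` D \<longleftrightarrow> p - 1 \<in> D" by (cases p) auto
    then show "f (des (Suc m) (insert_max m p w)) = (if p \<in> Suc ` D then f (card D) else f (Suc (card D)))"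
      using des_insert_max[OF w, of p, folded D_def] p by (simp add: d)
  qed
  also have "\<dots> = of_nat (card D) * f (card D) + of_nat (m - card D) * f (Suc (card D))"
    using T by (simp add: sum.If_cases Int_absorb1 card_image Diff_eq[symmetric] card_Diff_subset fin)
  moreover have "f (des (Suc m) (insert_max m (Suc m) w)) = f (card D)"
    using des_insert_max[OF w, of "Suc m"] by (simp add: d)
  ultimately show ?thesis by (simp add: d algebra_simps)
qed

lemma des_le: "des m w \<le> m"
proof -
  have "des m w \<le> card {1..<m}" unfolding des_def by (rule card_mono) auto
  then show ?thesis by simp
qed

section \<open>Recurrence, generating function and shift identity of the Eulerian
  polynomials\<close>

lemma eulerian_poly_0 [simp]: "eulerian_poly 0 = 1"
  by (simp add: eulerian_poly_def sym_group_def des_def)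

lemma pderiv_sum: "pderiv (sum f A) = (\<Sum>a\<in>A. pderiv (f a))"
  by (induction A rule: infinite_finite_induct) (simp_all add: pderiv_add)

lemma eulerian_poly_Suc:
  "eulerian_poly (Suc m) = (1 + of_nat m * [:0, 1:]) * eulerian_poly m
     + [:0, 1:] * (1 - [:0, 1:]) * pderiv (eulerian_poly m)"
proof -
  define X :: "rat poly" where "X = [:0, 1:]"
  have mon: "monom 1 d = X ^ d" for d by (simp add: X_def monom_altdef)
  have dX: "pderiv X = 1" by (simp add: X_def pderiv_pCons)
  have dXp: "X * pderiv (X ^ d) = of_nat d * X ^ d" for d
    by (cases d) (simp_all add: pderiv_power_Suc dX of_nat_poly del: of_nat_Suc power_Suc, simp)
  have "eulerian_poly (Suc m) = (\<Sum>w\<in>sym_group m. of_nat (Suc (des m w)) * X ^ des m w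
      + of_nat (m - des m w) * X ^ Suc (des m w))"
    by (simp only: eulerian_poly_def sum_sym_group_Suc mon)
      (intro sum.cong refl sum_insert_max[of _ m "\<lambda>d. X ^ d"])
  also have "\<dots> = (\<Sum>w\<in>sym_group m. (1 + of_nat m * X) * X ^ des m w
      + (1 - X) * (X * pderiv (X ^ des m w)))"
    \<comment> \<open>\<open>des_le\<close> turns the truncated difference
      \<open>m - des m w\<close> into a true one, and the factors d in d x^d become x times a
      derivative.\<close>
    using des_le by (intro sum.cong refl) (simp add: dXp algebra_simps)
  also have "\<dots> = (1 + of_nat m * X) * eulerian_poly m + (1 - X) * (X * pderiv (eulerian_poly m))"
    by (simp add: eulerian_poly_def mon sum.distrib sum_distrib_left pderiv_sum)
  finally show ?thesis by (simp add: X_def algebra_simps)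
qed

text \<open>The operator S + x S' multiplies the coefficient of x^t by t+1, hence raises the
  exponent m by one; under the factor (1-x)^(m+1) it becomes the Eulerian recurrence.\<close>

lemma fps_eulerian_poly:
  "fps_of_poly (eulerian_poly m) = (1 - fps_X) ^ Suc m * Abs_fps (\<lambda>t. of_nat (Suc t) ^ m)"
proof (induction m)
  case 0
  have "(1 - fps_X) * Abs_fps (\<lambda>t. 1 :: rat) = 1"
    by (simp add: fps_eq_iff left_diff_distrib)
  then show ?case by simp
next
  case (Suc m)
  define S :: "nat \<Rightarrow> rat fps" where "S m = Abs_fps (\<lambda>t. of_nat (Suc t) ^ m)" for m
  define E where "E = fps_of_poly (eulerian_poly m)"
  have S: "S (Suc m) = S m + fps_X * fps_deriv (S m)"
    by (simp add: fps_mult_fps_X_deriv_shift) (simp add: S_def fps_eq_iff algebra_simps)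
  have E: "E = (1 - fps_X) ^ Suc m * S m" using Suc by (simp add: E_def S_def)
  have dE: "fps_deriv E = (1 - fps_X) ^ Suc m * fps_deriv (S m) - of_nat (Suc m) * (1 - fps_X) ^ m * S m"
    unfolding E by (simp add: fps_deriv_power' del: power_Suc of_nat_Suc)
  have "fps_of_poly (eulerian_poly (Suc m)) = (1 + of_nat m * fps_X) * E + fps_X * (1 - fps_X) * fps_deriv E"
    by (simp add: eulerian_poly_Suc E_def fps_of_poly_add fps_of_poly_mult fps_of_poly_diff
        fps_of_poly_pderiv of_nat_poly fps_of_poly_const fps_of_nat del: mult_pCons_left mult_pCons_right)
  also have "\<dots> = (1 - fps_X) ^ Suc (Suc m) * S (Suc m)"
    unfolding dE S unfolding E by (simp add: algebra_simps)
  finally show ?case by (simp add: S_def)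
qed

text \<open>Expanding (t+2)^m = ((t+1)+1)^m expresses the shifted power series through the unshifted
  ones. Subtracting x times the shifted series leaves only its term at t = 0, which is 1.\<close>

lemma eulerian_poly_functional:
  "eulerian_poly m - [:0, 1:] * (\<Sum>j\<le>m. of_nat (m choose j) * [:1, -1:] ^ (m - j) * eulerian_poly j)
    = [:1, -1:] ^ Suc m"
proof -
  define S :: "nat \<Rightarrow> rat fps" where "S m = Abs_fps (\<lambda>t. of_nat (Suc t) ^ m)" for m
  have binom: "(\<Sum>j\<le>m. of_nat (m choose j) * S j) = Abs_fps (\<lambda>t. of_nat (Suc (Suc t)) ^ m)"
  proof (rule fps_ext)
    fix t
    have "of_nat (Suc (Suc t)) ^ m = (of_nat (Suc t) + 1 :: rat) ^ m" by (simp add: add_ac)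
    also have "\<dots> = (\<Sum>j\<le>m. of_nat (m choose j) * of_nat (Suc t) ^ j)" 
      unfolding binomial_ring by simp
    finally show "(\<Sum>j\<le>m. of_nat (m choose j) * S j) $ t = Abs_fps (\<lambda>t. of_nat (Suc (Suc t)) ^ m) $ t"
      by (simp add: fps_sum_nth S_def fps_of_nat[symmetric])
  qed
  have shift: "S m - fps_X * Abs_fps (\<lambda>t. of_nat (Suc (Suc t)) ^ m) = 1"
    by (auto simp: fps_eq_iff S_def)
  have X: "fps_of_poly [:1, -1:] = (1 - fps_X :: rat fps)"
    by (simp add: fps_of_poly_pCons fps_of_poly_const)
  have "(\<Sum>j\<le>m. of_nat (m choose j) * (1 - fps_X) ^ (m - j) * fps_of_poly (eulerian_poly j))
     = (\<Sum>j\<le>m. (1 - fps_X) ^ Suc m * (of_nat (m choose j) * S j))"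
  \<comment> \<open>The powers (1-x)^(m-j) bring all summands to the common factor
    (1-x)^(m+1).\<close>
  proof (rule sum.cong[OF refl])
    fix j assume "j \<in> {..m}"
    then have "(1 - fps_X :: rat fps) ^ Suc m = (1 - fps_X) ^ (m - j) * (1 - fps_X) ^ Suc j"
      by (simp only: power_add[symmetric]) simp
    then show "of_nat (m choose j) * (1 - fps_X) ^ (m - j) * fps_of_poly (eulerian_poly j)
       = (1 - fps_X) ^ Suc m * (of_nat (m choose j) * S j)"
      by (simp only: fps_eulerian_poly S_def) (simp only: mult_ac)
  qed
  also have "\<dots> = (1 - fps_X) ^ Suc m * Abs_fps (\<lambda>t. of_nat (Suc (Suc t)) ^ m)"
    by (simp only: sum_distrib_left[symmetric] binom)
  finally have sum: "(\<Sum>j\<le>m. of_nat (m choose j) * (1 - fps_X) ^ (m - j) * fps_of_poly (eulerian_poly j))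
     = (1 - fps_X) ^ Suc m * Abs_fps (\<lambda>t. of_nat (Suc (Suc t)) ^ m)" .
  have ofnat: "fps_of_poly (of_nat k) = (of_nat k :: rat fps)" for k
    by (simp add: of_nat_poly fps_of_poly_const fps_of_nat)
  have "fps_of_poly (eulerian_poly m - [:0, 1:] * (\<Sum>j\<le>m. of_nat (m choose j) * [:1, -1:] ^ (m - j) * eulerian_poly j))
    = fps_of_poly (eulerian_poly m) - fps_X * (\<Sum>j\<le>m. of_nat (m choose j) * (1 - fps_X) ^ (m - j) * fps_of_poly (eulerian_poly j))"
    by (simp only: fps_of_poly_diff fps_of_poly_mult fps_of_poly_sum fps_of_poly_power X ofnat fps_of_poly_fps_X)
  also have "\<dots> = (1 - fps_X) ^ Suc m * (S m - fps_X * Abs_fps (\<lambda>t. of_nat (Suc (Suc t)) ^ m))"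
    unfolding sum fps_eulerian_poly[of m] S_def by (simp only: algebra_simps)
  also have "\<dots> = fps_of_poly ([:1, -1:] ^ Suc m)"
    by (simp only: shift fps_of_poly_power X mult_1_right)
  finally show ?thesis by (simp only: fps_of_poly_eq_iff)
qed

text \<open>The linear functional $y^m \mapsto E_m(x)$ on polynomials in $y$.\<close>

definition eulerian_functional :: "rat \<Rightarrow> rat poly \<Rightarrow> rat" where
  "eulerian_functional x p = (\<Sum>i\<le>degree p. coeff p i * poly (eulerian_poly i) x)"

lemma eulerian_functional_upto:
  assumes "degree p \<le> n"
  shows "eulerian_functional x p = (\<Sum>i\<le>n. coeff p i * poly (eulerian_poly i) x)"
  unfolding eulerian_functional_def
  by (rule sum.mono_neutral_left) (use assms in \<open>auto simp: coeff_eq_0\<close>)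

lemma eulerian_functional_add:
  "eulerian_functional x (p + q) = eulerian_functional x p + eulerian_functional x q"
proof -
  let ?n = "max (degree p) (degree q)"
  have "degree (p + q) \<le> ?n" by (rule degree_add_le_max)
  then show ?thesis
    by (simp add: eulerian_functional_upto[of _ ?n] sum.distrib distrib_right)
qed

lemma eulerian_functional_smult:
  "eulerian_functional x (smult c p) = c * eulerian_functional x p"
  by (simp add: eulerian_functional_upto[OF degree_smult_le] eulerian_functional_def sum_distrib_left mult.assoc)

lemma eulerian_functional_0: "eulerian_functional x 0 = 0"
  by (simp add: eulerian_functional_def)

lemma eulerian_functional_sum:
  "eulerian_functional x (\<Sum>a\<in>A. f a) = (\<Sum>a\<in>A. eulerian_functional x (f a))"
  by (induction A rule: infinite_finite_induct) (simp_all add: eulerian_functional_0 eulerian_functional_add)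

lemma eulerian_functional_monom:
  "eulerian_functional x (monom c m) = c * poly (eulerian_poly m) x"
proof -
  have "eulerian_functional x (monom c m) = (\<Sum>i\<le>m. if i = m then c * poly (eulerian_poly m) x else 0)"
    unfolding eulerian_functional_upto[OF degree_monom_le] by (intro sum.cong) auto
  then show ?thesis by simp
qed

lemma pcompose_monom: "pcompose (monom 1 m) q = q ^ m"
  by (induction m) (simp_all add: monom_Suc pcompose_pCons pcompose_1)

text \<open>For p = y^m this is \<open>eulerian_poly_functional\<close> evaluated at x, and both
  sides are linear in p.\<close>

lemma eulerian_functional_shift:
  "eulerian_functional x p - x * eulerian_functional x (pcompose p [:1 - x, 1:]) = (1 - x) * poly p (1 - x)"
proof -
  let ?L = "eulerian_functional x"
  have mon: "?L (monom 1 m) - x * ?L (pcompose (monom 1 m) [:1 - x, 1:]) = (1 - x) ^ Suc m" for m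
  proof -
    have "pcompose (monom 1 m) [:1 - x, 1:] = (monom 1 1 + [:1 - x:]) ^ m"
      unfolding pcompose_monom by (simp add: monom_altdef)
    also have "\<dots> = (\<Sum>j\<le>m. monom (of_nat (m choose j) * (1 - x) ^ (m - j)) j)"
      unfolding binomial_ring
      by (intro sum.cong refl)
        (simp add: monom_power poly_const_pow of_nat_poly smult_monom mult.commute)
    finally have "?L (pcompose (monom 1 m) [:1 - x, 1:]) =
        (\<Sum>j\<le>m. of_nat (m choose j) * (1 - x) ^ (m - j) * poly (eulerian_poly j) x)"
      by (simp add: eulerian_functional_sum eulerian_functional_monom)
    moreover have "poly (eulerian_poly m) x - x * (\<Sum>j\<le>m. of_nat (m choose j) * (1 - x) ^ (m - j) * poly (eulerian_poly j) x)
      = (1 - x) ^ Suc m"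
      using arg_cong[OF eulerian_poly_functional[of m], of "\<lambda>p. poly p x"] by (simp add: poly_sum left_diff_distrib)
    ultimately show ?thesis by (simp add: eulerian_functional_monom)
  qed
  \<comment> \<open>\<open>T\<close> is the defect of the identity, additive in p and zero on
    monomials.\<close>
  define T where "T p = ?L p - x * ?L (pcompose p [:1 - x, 1:]) - (1 - x) * poly p (1 - x)" for p
  have T0: "T (monom c m) = 0" for c m
  proof -
    have "monom c m = smult c (monom 1 m)" by (simp add: smult_monom)
    then have "T (monom c m) = c * (?L (monom 1 m) - x * ?L (pcompose (monom 1 m) [:1 - x, 1:]) - (1 - x) ^ Suc m)"
      by (simp add: T_def pcompose_smult eulerian_functional_smult poly_monom algebra_simps)
    then show ?thesis using mon[of m] by simp
  qed
  have Tsum: "T (\<Sum>a\<in>A. f a) = (\<Sum>a\<in>A. T (f a))" for f and A :: "nat set"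
    by (simp add: T_def pcompose_sum eulerian_functional_sum poly_sum sum_subtractf sum_distrib_left)
  have "T p = T (\<Sum>i\<le>degree p. monom (coeff p i) i)" by (simp add: poly_as_sum_of_monoms)
  also have "\<dots> = 0" by (simp add: Tsum T0)
  finally show ?thesis by (simp add: T_def)
qed

section \<open>The exponential formula for cycles\<close>

lemma finite_perm_cycles [simp]: "finite (perm_cycles n w)"
  by (simp add: perm_cycles_def)

section \<open>Cycles under insertion of a new element\<close>

lemma orbit_eq_of_mem:
  assumes "permutation p" and "x \<in> orbit p y"
  shows "orbit p x = orbit p y"
  using orbit_cyclic_eq3[OF cyclic_on_orbit'[OF assms(1)] assms(2)] .

text \<open>The transposition redirects the arrow that enters b to a, and sends a to b. So a is
  spliced into the cycle of b just before b, and nothing else changes.\<close>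

lemma orbit_transpose_comp:
  assumes p: "p permutes S" and fin: "finite S" and a: "a \<notin> S" and b: "b \<in> S"
  defines "q \<equiv> transpose a b \<circ> p"
  shows "orbit q b = insert a (orbit p b)"
    and "x \<in> S \<Longrightarrow> x \<notin> orbit p b \<Longrightarrow> orbit q x = orbit p x"
proof -
  have pp: "permutation p" using p fin by (auto simp: permutation_permutes)
  have q: "q permutes insert a S"
    unfolding q_def using p b
    by (intro permutes_compose permutes_swap_id permutes_subset[OF p]) auto
  then have qp: "permutation q" using fin by (metis finite_insert permutation_permutes)
  have pa: "p a = a" using permutes_not_in[OF p a] .
  have O: "orbit p b \<subseteq> S" using permutes_orbit_subset[OF p b] .
  have bO: "b \<in> orbit p b" by (rule permutation_self_in_orbit[OF pp])
  have bq: "b \<in> orbit q b" by (rule permutation_self_in_orbit[OF qp])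
  have pO: "p y \<in> orbit p b" if "y \<in> orbit p b" for y using that by (rule orbit.step)
  have qv: "q y = (if p y = b then a else p y)" if "y \<in> S" for y
  proof -
    have "p y \<noteq> a" using permutes_in_image[OF p, of y] that a by auto
    then show ?thesis by (auto simp: q_def transpose_def)
  qed
  have qa: "q a = b" by (simp add: q_def pa)
  show "orbit q b = insert a (orbit p b)"
  proof
    show "orbit q b \<subseteq> insert a (orbit p b)"
    proof
      fix y assume "y \<in> orbit q b"
      then show "y \<in> insert a (orbit p b)"
      proof induction
        case base
        then show ?case using qv[OF b] pO[OF bO] by auto
      next
        case (step y)
        show ?case
        proof (cases "y = a")
          case True
          then show ?thesis using qa bO by simp
        next
          case False
          then have y: "y \<in> orbit p b" using step.IH by simp
          then have "y \<in> S" using O by blast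
          then show ?thesis using qv[of y] pO[OF y] by auto
        qed
      qed
    qed
    have sub: "y \<in> orbit q b" if "y \<in> orbit p b" for y
      using that
    proof induction
      case base
      then show ?case using qv[OF b] orbit.base[of q b] bq by (auto split: if_splits)
    next
      case (step y)
      then have "y \<in> S" using O by blast
      then show ?case using qv[of y] orbit.step[OF step.IH] bq by (auto split: if_splits)
    qed
    moreover have "a \<in> orbit q b"
    proof -
      from bO obtain y where y: "y \<in> orbit p b" "p y = b"
        by (cases rule: orbit.cases) (use bO in auto)
      then have "q y = a" using qv[of y] O by auto
      then show ?thesis using orbit.step[OF sub[OF y(1)]] by simp
    qed
    ultimately show "insert a (orbit p b) \<subseteq> orbit q b" by blast
  qed
  assume x: "x \<in> S" "x \<notin> orbit p b"
  show "orbit q x = orbit p x"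
  proof (rule orbit_cong)
    show "x \<in> orbit p x" by (rule permutation_self_in_orbit[OF pp])
    fix s assume s: "s \<in> orbit p x"
    then have "s \<in> S" using permutes_orbit_subset[OF p x(1)] by blast
    moreover have "p s \<noteq> b"
    proof
      assume "p s = b"
      then have "b \<in> orbit p x" using orbit.step[OF s] by simp
      then show False using orbit_eq_of_mem[OF pp] permutation_self_in_orbit[OF pp, of x] x(2) by metis
    qed
    ultimately show "q s = p s" using qv[of s] by simp
  qed
qed

lemma perm_cycles_transpose_comp:
  assumes p: "p permutes {1..n}" and b: "b \<in> {1..n}"
  shows "perm_cycles (Suc n) (transpose (Suc n) b \<circ> p) =
    insert (insert (Suc n) (orbit p b)) (perm_cycles n p - {orbit p b})"
proof -
  define q where "q = transpose (Suc n) b \<circ> p"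
  have pp: "permutation p" using p by (auto simp: permutation_permutes)
  have "q permutes insert (Suc n) {1..n}"
    unfolding q_def using b
    by (intro permutes_compose permutes_swap_id permutes_subset[OF p]) auto
  then have qp: "permutation q" by (metis finite_insert finite_atLeastAtMost permutation_permutes)
  note T = orbit_transpose_comp[OF p finite_atLeastAtMost _ b, of "Suc n", folded q_def]
  have in1: "orbit q x = insert (Suc n) (orbit p b)" if "x \<in> insert (Suc n) (orbit p b)" for x
    using orbit_eq_of_mem[OF qp, of x b] T(1) that by simp
  have mem: "x \<in> orbit p b \<longleftrightarrow> orbit p x = orbit p b" for x
    using orbit_eq_of_mem[OF pp] permutation_self_in_orbit[OF pp] by blast
  have "orbit q ` insert (Suc n) {1..n} = insert (insert (Suc n) (orbit p b)) (orbit p ` {1..n} - {orbit p b})"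
    (is "?l = ?r")
  proof
    show "?l \<subseteq> ?r"
    proof
      fix c assume "c \<in> ?l"
      then obtain x where x: "x \<in> insert (Suc n) {1..n}" "c = orbit q x" by blast
      show "c \<in> ?r"
      proof (cases "x \<in> insert (Suc n) (orbit p b)")
        case True
        then show ?thesis using in1 x by simp
      next
        case False
        then show ?thesis using x T(2)[of x] mem[of x] by auto
      qed
    qed
    show "?r \<subseteq> ?l"
    proof
      fix c assume "c \<in> ?r"
      then consider "c = insert (Suc n) (orbit p b)"
        | x where "x \<in> {1..n}" "c = orbit p x" "c \<noteq> orbit p b" by blast
      then show "c \<in> ?l"
      proof cases
        case 1
        then show ?thesis using in1[of "Suc n"] by auto
      next
        case 2
        then show ?thesis using T(2)[of x] mem[of x] by auto
      qed
    qed
  qed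
  moreover have "{1..Suc n} = insert (Suc n) {1..n}" by auto
  ultimately show ?thesis by (simp add: perm_cycles_def q_def)
qed

lemma perm_cycles_Suc_fixed:
  assumes p: "p permutes {1..n}"
  shows "perm_cycles (Suc n) p = insert {Suc n} (perm_cycles n p)"
proof -
  have "{1..Suc n} = insert (Suc n) {1..n}" by auto
  moreover have "orbit p (Suc n) = {Suc n}"
    using permutes_not_in[OF p, of "Suc n"] by (simp add: orbit_eq_singleton_iff)
  ultimately show ?thesis by (simp add: perm_cycles_def)
qed

lemma perm_cycles_subset:
  assumes "p permutes {1..n}" and "c \<in> perm_cycles n p"
  shows "c \<subseteq> {1..n}"
  using assms(2) permutes_orbit_subset[OF assms(1)] unfolding perm_cycles_def by blast

lemma sum_over_cycles:
  fixes g :: "nat set \<Rightarrow> 'a :: comm_semiring_1"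
  assumes p: "p permutes {1..n}"
  shows "(\<Sum>b\<in>{1..n}. g (orbit p b)) = (\<Sum>c\<in>perm_cycles n p. of_nat (card c) * g c)"
proof -
  have pp: "permutation p" using p by (auto simp: permutation_permutes)
  have "(\<Sum>b\<in>{1..n}. g (orbit p b)) = (\<Sum>c\<in>perm_cycles n p. \<Sum>b\<in>{b \<in> {1..n}. orbit p b = c}. g (orbit p b))"
    unfolding perm_cycles_def by (rule sum.image_gen) simp
  also have "\<dots> = (\<Sum>c\<in>perm_cycles n p. of_nat (card c) * g c)"
  proof (rule sum.cong[OF refl])
    fix c assume c: "c \<in> perm_cycles n p"
    then obtain x where x: "c = orbit p x" by (auto simp: perm_cycles_def)
    have "{b \<in> {1..n}. orbit p b = c} = c"
      using perm_cycles_subset[OF p c] orbit_eq_of_mem[OF pp] permutation_self_in_orbit[OF pp]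
      unfolding x by blast
    moreover have "(\<Sum>b\<in>{b \<in> {1..n}. orbit p b = c}. g (orbit p b)) = (\<Sum>b\<in>{b \<in> {1..n}. orbit p b = c}. g c)"
      by (rule sum.cong) auto
    ultimately show "(\<Sum>b\<in>{b \<in> {1..n}. orbit p b = c}. g (orbit p b)) = of_nat (card c) * g c" by simp
  qed
  finally show ?thesis .
qed

text \<open>Each permutation of \<open>{1..Suc n}\<close> is uniquely a transposition of
  \<open>Suc n\<close> with some b after a permutation of \<open>{1..n}\<close>. The choice b =
  \<open>Suc n\<close> adds a fixed point; any other b lengthens its own cycle, and a cycle of
  length j contains j such b.\<close>

lemma sum_prod_cycles_Suc:
  fixes f :: "nat \<Rightarrow> 'a :: comm_semiring_1"
  shows "(\<Sum>w\<in>sym_group (Suc n). \<Prod>c\<in>perm_cycles (Suc n) w. f (card c)) =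
    (\<Sum>w\<in>sym_group n. f 1 * (\<Prod>c\<in>perm_cycles n w. f (card c)) +
      (\<Sum>c\<in>perm_cycles n w. of_nat (card c) * f (Suc (card c)) * (\<Prod>c'\<in>perm_cycles n w - {c}. f (card c'))))"
proof -
  let ?P = "\<lambda>n w. \<Prod>c\<in>perm_cycles n w. f (card c)"
  have ins: "{1..Suc n} = insert (Suc n) {1..n}" by auto
  have "(\<Sum>w\<in>sym_group (Suc n). ?P (Suc n) w) =
    (\<Sum>w\<in>sym_group n. \<Sum>b\<in>insert (Suc n) {1..n}. ?P (Suc n) (transpose (Suc n) b \<circ> w))"
    unfolding sym_group_def ins by (subst sum_over_permutations_insert) (simp, simp, rule sum.swap)
  also have "\<dots> = (\<Sum>w\<in>sym_group n. f 1 * ?P n w +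
      (\<Sum>c\<in>perm_cycles n w. of_nat (card c) * f (Suc (card c)) * (\<Prod>c'\<in>perm_cycles n w - {c}. f (card c'))))"
  proof (rule sum.cong[OF refl])
    fix w assume "w \<in> sym_group n"
    then have w: "w permutes {1..n}" by (simp add: sym_group_def)
    \<comment> \<open>A cycle through \<open>Suc n\<close> is not among the old ones, so its factor
      splits off the product.\<close>
    have notin: "c \<notin> perm_cycles n w" if "Suc n \<in> c" for c
      using perm_cycles_subset[OF w, of c] that by fastforce
    have "?P (Suc n) (transpose (Suc n) (Suc n) \<circ> w) = f 1 * ?P n w"
      using notin[of "{Suc n}"] by (simp add: perm_cycles_Suc_fixed[OF w])
    moreover
    have "?P (Suc n) (transpose (Suc n) b \<circ> w) =
       f (Suc (card (orbit w b))) * (\<Prod>c'\<in>perm_cycles n w - {orbit w b}. f (card c'))" if b: "b \<in> {1..n}" for b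
    proof -
      have "orbit w b \<subseteq> {1..n}" by (rule permutes_orbit_subset[OF w b])
      moreover from this have "finite (orbit w b)" by (rule finite_subset) simp
      ultimately have "finite (orbit w b)" "Suc n \<notin> orbit w b" by fastforce+
      then show ?thesis
        using notin[of "insert (Suc n) (orbit w b)"] by (simp add: perm_cycles_transpose_comp[OF w b])
    qed
    then have "(\<Sum>b\<in>{1..n}. ?P (Suc n) (transpose (Suc n) b \<circ> w)) =
      (\<Sum>c\<in>perm_cycles n w. of_nat (card c) * f (Suc (card c)) * (\<Prod>c'\<in>perm_cycles n w - {c}. f (card c')))"
      using sum_over_cycles[OF w, of "\<lambda>c. f (Suc (card c)) * (\<Prod>c'\<in>perm_cycles n w - {c}. f (card c'))"]
      by (simp only: mult.assoc cong: sum.cong)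
    ultimately show "(\<Sum>b\<in>insert (Suc n) {1..n}. ?P (Suc n) (transpose (Suc n) b \<circ> w)) =
      f 1 * ?P n w + (\<Sum>c\<in>perm_cycles n w. of_nat (card c) * f (Suc (card c)) * (\<Prod>c'\<in>perm_cycles n w - {c}. f (card c')))"
      by (subst sum.insert) simp_all
  qed
  finally show ?thesis .
qed

section \<open>Cycle weights as derivatives of power series\<close>

lemma fps_prod_nth_0:
  fixes f :: "'b \<Rightarrow> 'a :: comm_semiring_1 fps"
  shows "prod f A $ 0 = (\<Prod>a\<in>A. f a $ 0)"
  by (induction A rule: infinite_finite_induct) simp_all

lemma fps_deriv_prod:
  fixes f :: "'b \<Rightarrow> 'a :: comm_ring_1 fps"
  assumes "finite A"
  shows "fps_deriv (prod f A) = (\<Sum>a\<in>A. fps_deriv (f a) * prod f (A - {a}))"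
  using assms
proof induction
  case (insert x A)
  have "(\<Sum>a\<in>A. fps_deriv (f a) * prod f (insert x A - {a})) = f x * (\<Sum>a\<in>A. fps_deriv (f a) * prod f (A - {a}))"
    unfolding sum_distrib_left
  proof (rule sum.cong[OF refl])
    fix a assume "a \<in> A"
    then have "insert x A - {a} = insert x (A - {a})" using insert by auto
    then show "fps_deriv (f a) * prod f (insert x A - {a}) = f x * (fps_deriv (f a) * prod f (A - {a}))"
      using insert.hyps by (simp add: mult_ac)
  qed
  moreover have "insert x A - {x} = A" using insert by auto
  ultimately show ?case using insert by (simp add: add.commute mult.commute)
qed simp

lemma card_perm_cycle_pos:
  assumes "w \<in> sym_group n" and "c \<in> perm_cycles n w"
  shows "card c > 0"
proof -
  have "w permutes {1..n}" using assms(1) by (simp add: sym_group_def)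
  then have "finite c" using perm_cycles_subset[OF _ assms(2)] by (metis finite_atLeastAtMost finite_subset)
  moreover have "c \<noteq> {}" using assms(2) orbit_nonempty[of w] by (auto simp: perm_cycles_def)
  ultimately show ?thesis by (simp add: card_gt_0_iff)
qed

text \<open>
  Inserting a new largest element into a cycle of length $j$ can be done in $j$ ways, so it acts on
  cycle weights as the derivation $f_j \mapsto j f_{j+1}$. The weights $f_j = F^{(j-1)} / (j-1)!$
  realise this derivation as differentiation of power series, and $c_{n+1} = F c_n + c_n'$
  integrates to $c_n H = H^{(n)}$.
\<close>

lemma exponential_formula_cycles:
  fixes F H :: "'a :: {comm_ring_1, ring_char_0} fps"
  assumes H: "fps_deriv H = F * H" and H0: "H $ 0 = 1"
  shows "(\<Sum>w\<in>sym_group n. \<Prod>c\<in>perm_cycles n w. F $ (card c - 1)) = fact n * H $ n"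
proof -
  \<comment> \<open>Writing F^(j-1) / (j-1)! with binomial coefficients avoids division in the
    ring.\<close>
  define f where "f j = Abs_fps (\<lambda>i. of_nat ((i + j - 1) choose i) * F $ (i + j - 1))" for j
  have f1: "f 1 = F" by (simp add: f_def fps_eq_iff)
  have df: "fps_deriv (f j) = of_nat j * f (Suc j)" if "j > 0" for j
  proof (rule fps_ext)
    fix i
    have "(i + 1) * ((i + j) choose (i + 1)) = j * ((i + j) choose i)"
      using binomial_absorb_comp[of "i + j" i] binomial_absorption[of i "i + j"] that by simp
    then have "of_nat (i + 1) * of_nat ((i + j) choose (i + 1)) = (of_nat j * of_nat ((i + j) choose i) :: 'a)"
      by (simp only: of_nat_mult[symmetric])
    then show "fps_deriv (f j) $ i = (of_nat j * f (Suc j)) $ i"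
      by (simp add: f_def mult.assoc[symmetric] del: of_nat_add of_nat_Suc)
  qed
  define c where "c n = (\<Sum>w\<in>sym_group n. \<Prod>c\<in>perm_cycles n w. f (card c))" for n
  have cSuc: "c (Suc n) = F * c n + fps_deriv (c n)" for n
  proof -
    have "c (Suc n) = (\<Sum>w\<in>sym_group n. F * (\<Prod>c\<in>perm_cycles n w. f (card c)) +
      (\<Sum>c\<in>perm_cycles n w. of_nat (card c) * f (Suc (card c)) * (\<Prod>c'\<in>perm_cycles n w - {c}. f (card c'))))"
      unfolding c_def sum_prod_cycles_Suc f1 ..
    also have "\<dots> = (\<Sum>w\<in>sym_group n. F * (\<Prod>c\<in>perm_cycles n w. f (card c)) + fps_deriv (\<Prod>c\<in>perm_cycles n w. f (card c)))"
    proof (intro sum.cong refl arg_cong2[where f = "(+)"])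
      fix w assume "w \<in> sym_group n"
      note card_perm_cycle_pos[OF this]
      then show "(\<Sum>c\<in>perm_cycles n w. of_nat (card c) * f (Suc (card c)) * (\<Prod>c'\<in>perm_cycles n w - {c}. f (card c')))
        = fps_deriv (\<Prod>c\<in>perm_cycles n w. f (card c))"
        by (subst fps_deriv_prod) (auto intro!: sum.cong simp: df)
    qed
    also have "\<dots> = F * c n + fps_deriv (c n)"
      by (simp add: c_def sum.distrib sum_distrib_left fps_deriv_sum)
    finally show ?thesis .
  qed
  have "c n * H = (fps_deriv ^^ n) H" for n
  proof (induction n)
    case 0
    then show ?case by (simp add: c_def sym_group_def perm_cycles_def)
  next
    case (Suc n)
    have "(fps_deriv ^^ Suc n) H = fps_deriv (c n * H)" using Suc by simp
    also have "\<dots> = c (Suc n) * H" by (simp add: cSuc H algebra_simps)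
    finally show ?case ..
  qed
  then have "(c n * H) $ 0 = fact n * H $ n" by (simp add: fps_0th_higher_deriv)
  \<comment> \<open>The constant term of \<open>f j\<close> is \<open>F $ (j - 1)\<close>, the
    weight wanted for a cycle of length j.\<close>
  moreover have "c n $ 0 = (\<Sum>w\<in>sym_group n. \<Prod>c\<in>perm_cycles n w. F $ (card c - 1))"
    unfolding c_def by (simp add: fps_sum_nth fps_prod_nth_0 f_def)
  ultimately show ?thesis by (simp add: H0)
qed

section \<open>Lagrange inversion and the Narayana series\<close>

text \<open>Since g has no constant term, g^i starts in degree i. All inner sums may thus run up to
  n, and the two summations can be exchanged.\<close>

lemma fps_compose_mult_nth:
  fixes c g q :: "'a :: comm_ring_1 fps"
  assumes "g $ 0 = 0"
  shows "((c oo g) * q) $ n = (\<Sum>i\<le>n. c $ i * (g ^ i * q) $ n)"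
proof -
  have comp: "(c oo g) $ j = (\<Sum>i\<le>n. c $ i * (g ^ i) $ j)" if "j \<le> n" for j
    unfolding fps_compose_nth
    by (rule sum.mono_neutral_left) (use that assms in \<open>auto simp: startsby_zero_power_prefix\<close>)
  have "((c oo g) * q) $ n = (\<Sum>j=0..n. \<Sum>i\<le>n. c $ i * (g ^ i) $ j * q $ (n - j))"
    unfolding fps_mult_nth by (rule sum.cong) (simp_all add: comp sum_distrib_right)
  also have "\<dots> = (\<Sum>i\<le>n. c $ i * (g ^ i * q) $ n)"
    unfolding fps_mult_nth sum_distrib_left by (subst sum.swap) (simp add: mult.assoc)
  finally show ?thesis .
qed

text \<open>For m > 0, m times the series is m R - z R' with R = \<phi>^m. Its coefficient at z^m is
  m r - m r = 0 for r the coefficient of R, and m cancels in characteristic 0.\<close>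

lemma lagrange_diagonal:
  fixes \<phi> :: "'a :: field_char_0 fps"
  assumes "\<phi> $ 0 = 1"
  shows "(\<phi> ^ m * (1 - fps_X * fps_deriv \<phi> * inverse \<phi>)) $ m = (if m = 0 then 1 else 0)"
proof (cases m)
  case (Suc l)
  have inv: "\<phi> * inverse \<phi> = 1" using assms by (intro inverse_mult_eq_1') simp
  have "of_nat m * (\<phi> ^ m * (1 - fps_X * fps_deriv \<phi> * inverse \<phi>)) =
      of_nat m * \<phi> ^ m - fps_X * (of_nat m * fps_deriv \<phi> * \<phi> ^ l) * (\<phi> * inverse \<phi>)"
    by (simp add: Suc algebra_simps)
  also have "\<dots> = of_nat m * \<phi> ^ m - fps_X * fps_deriv (\<phi> ^ m)"
    unfolding inv fps_deriv_power'[of \<phi> m] by (simp only: Suc diff_Suc_1 mult_1_right)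
  finally have "(of_nat m * (\<phi> ^ m * (1 - fps_X * fps_deriv \<phi> * inverse \<phi>))) $ m =
      (of_nat m * \<phi> ^ m - fps_X * fps_deriv (\<phi> ^ m)) $ m" by simp
  also have "(of_nat m * R - fps_X * fps_deriv R) $ m = 0" for R :: "'a fps"
    by (simp add: Suc del: of_nat_Suc)
  finally show ?thesis by (simp add: Suc del: of_nat_Suc power_Suc)
qed simp

text \<open>
  Here $N$ solves $N = z \varphi(N)$. Expanding $K / (1 - u \varphi' / \varphi)$ in powers of
  $u / \varphi$ isolates a single coefficient by the previous lemma.
\<close>

theorem lagrange_inversion:
  fixes \<phi> K :: "'a :: field_char_0 fps"
  assumes \<phi>: "\<phi> $ 0 = 1"
  defines "N \<equiv> fps_inv (fps_X * inverse \<phi>)"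
  shows "((K * inverse (1 - fps_X * fps_deriv \<phi> * inverse \<phi>)) oo N) $ n = (K * \<phi> ^ n) $ n"
proof -
  define g where "g = fps_X * inverse \<phi>"
  define D where "D = 1 - fps_X * fps_deriv \<phi> * inverse \<phi>"
  define c where "c = (K * inverse D) oo N"
  have g: "g $ 0 = 0" "g $ 1 \<noteq> 0" using \<phi> by (simp_all add: g_def)
  have N0: "N $ 0 = 0" by (simp add: N_def fps_inv_def)
  have inv: "inverse \<phi> * \<phi> = 1" using \<phi> by (intro inverse_mult_eq_1) simp
  have "inverse D * D = 1" by (intro inverse_mult_eq_1) (simp add: D_def)
  \<comment> \<open>Since N is the compositional inverse of g, substituting g undoes the
    substitution of N.\<close>
  moreover have "c oo g = K * inverse D"
    unfolding c_def fps_compose_assoc[OF g(1) N0, symmetric]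
    by (simp add: N_def g_def[symmetric] fps_inv[OF g])
  ultimately have "K * \<phi> ^ n = (c oo g) * (\<phi> ^ n * D)" by (simp add: algebra_simps)
  also have "\<dots> $ n = (\<Sum>i\<le>n. c $ i * (g ^ i * (\<phi> ^ n * D)) $ n)"
    by (rule fps_compose_mult_nth[OF g(1)])
  also have "\<dots> = (\<Sum>i\<le>n. if i = n then c $ i else 0)"
  proof (rule sum.cong[OF refl])
    fix i assume "i \<in> {..n}"
    then have i: "i \<le> n" by simp
    \<comment> \<open>The factor \<phi>^i cancels the denominator of g^i, leaving z^i \<phi>^(n-i)
      D; \<open>lagrange_diagonal\<close> then kills every i < n.\<close>
    have "\<phi> ^ n = \<phi> ^ i * \<phi> ^ (n - i)" using i by (simp flip: power_add)
    then have "g ^ i * (\<phi> ^ n * D) = fps_X ^ i * (inverse \<phi> * \<phi>) ^ i * (\<phi> ^ (n - i) * D)"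
      by (simp only: g_def power_mult_distrib mult_ac)
    then have "g ^ i * (\<phi> ^ n * D) = fps_X ^ i * (\<phi> ^ (n - i) * D)"
      by (simp only: inv power_one mult_1_right)
    then have "(g ^ i * (\<phi> ^ n * D)) $ n = (\<phi> ^ (n - i) * D) $ (n - i)"
      using i by (simp only: fps_X_power_mult_nth) simp
    then show "c $ i * (g ^ i * (\<phi> ^ n * D)) $ n = (if i = n then c $ i else 0)"
      using i lagrange_diagonal[OF \<phi>, of "n - i"] by (simp add: D_def)
  qed
  also have "\<dots> = c $ n" by simp
  finally show ?thesis by (simp add: c_def D_def)
qed

text \<open>All parts rest on N / \<phi>(N) = z, which is the defining property of the compositional
  inverse.\<close>

lemma fps_inv_kernel:
  fixes \<phi> :: "'a :: field fps"
  assumes \<phi>: "\<phi> $ 0 = 1"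
  defines "N \<equiv> fps_inv (fps_X * inverse \<phi>)"
  shows "N $ 0 = 0" and "N = fps_X * (\<phi> oo N)"
    and "(1 - fps_X * fps_deriv \<phi> * inverse \<phi>) oo N = 1 - fps_X * (fps_deriv \<phi> oo N)"
proof -
  show N0: "N $ 0 = 0" by (simp add: N_def fps_inv_def)
  have "(fps_X * inverse \<phi>) oo N = fps_X"
    unfolding N_def using \<phi> by (intro fps_inv_right) simp_all
  then have X: "N * inverse (\<phi> oo N) = fps_X"
    using \<phi> N0 by (simp add: fps_compose_mult_distrib fps_inverse_compose)
  have inv: "inverse (\<phi> oo N) * (\<phi> oo N) = 1" using \<phi> by (intro inverse_mult_eq_1) simp
  have "fps_X * (\<phi> oo N) = N * (inverse (\<phi> oo N) * (\<phi> oo N))"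
    by (simp only: X[symmetric] mult.assoc)
  then show "N = fps_X * (\<phi> oo N)" by (simp add: inv)
  have "(1 - fps_X * fps_deriv \<phi> * inverse \<phi>) oo N = 1 - (N * inverse (\<phi> oo N)) * (fps_deriv \<phi> oo N)"
    using \<phi> N0 by (simp add: fps_compose_sub_distrib fps_compose_mult_distrib fps_inverse_compose mult_ac)
  then show "(1 - fps_X * fps_deriv \<phi> * inverse \<phi>) oo N = 1 - fps_X * (fps_deriv \<phi> oo N)"
    by (simp only: X)
qed

section \<open>The Narayana series of types A and B\<close>

lemma one_plus_const_X_power_nth:
  fixes c :: "'a :: comm_ring_1"
  shows "((1 + fps_const c * fps_X) ^ m) $ k = of_nat (m choose k) * c ^ k"
proof (induction m arbitrary: k)
  case 0
  then show ?case by (cases k) simp_all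
next
  case (Suc m)
  then show ?case by (cases k) (simp_all add: algebra_simps)
qed

definition narayana_kernel :: "rat \<Rightarrow> rat fps" where
  "narayana_kernel x = (1 + fps_X) * (1 + fps_const x * fps_X)"

definition narayana_gf :: "rat \<Rightarrow> rat fps" where
  "narayana_gf x = fps_inv (fps_X * inverse (narayana_kernel x))"

text \<open>The index is shifted: this is the derivative of the sum of B_j z^j / j, the form that
  \<open>exponential_formula_cycles\<close> takes as \<open>F\<close>.\<close>

definition narayana_B_gf :: "rat \<Rightarrow> rat fps" where
  "narayana_B_gf x = Abs_fps (\<lambda>n. poly (narayana_B_poly (Suc n)) x)"

lemma narayana_kernel_power_nth:
  "(narayana_kernel x ^ m) $ n = (\<Sum>k\<le>n. of_nat (m choose k) * of_nat (m choose (n - k)) * x ^ k)"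
proof -
  have "narayana_kernel x ^ m = (1 + fps_const x * fps_X) ^ m * (1 + fps_const 1 * fps_X) ^ m"
    by (simp add: narayana_kernel_def power_mult_distrib mult.commute)
  then show ?thesis
    by (simp only: fps_mult_nth one_plus_const_X_power_nth) (simp add: atMost_atLeast0 mult_ac)
qed

lemma narayana_kernel_0 [simp]: "narayana_kernel x $ 0 = 1"
  by (simp add: narayana_kernel_def)

lemma narayana_kernel_compose:
  assumes "N $ 0 = 0"
  shows "narayana_kernel x oo N = (1 + N) * (1 + fps_const x * N)"
    and "fps_deriv (narayana_kernel x) oo N = 1 + fps_const x + 2 * fps_const x * N"
  using assms
  by (simp_all add: narayana_kernel_def fps_compose_mult_distrib fps_compose_add_distrib algebra_simps)

lemma narayana_gf_0 [simp]: "narayana_gf x $ 0 = 0"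
  unfolding narayana_gf_def by (rule fps_inv_kernel) simp

lemma narayana_gf_eq:
  "narayana_gf x = fps_X * ((1 + narayana_gf x) * (1 + fps_const x * narayana_gf x))"
proof -
  have "narayana_gf x = fps_X * (narayana_kernel x oo narayana_gf x)"
    using fps_inv_kernel(2)[of "narayana_kernel x"] by (simp add: narayana_gf_def)
  then show ?thesis by (simp only: narayana_kernel_compose(1)[OF narayana_gf_0])
qed

text \<open>By symmetry of binomial coefficients, the squares in B_(n+1) are products of
  coefficients of (1 + x z)^n and (1 + z)^n.\<close>

lemma narayana_B_poly_Suc:
  "poly (narayana_B_poly (Suc n)) x = (narayana_kernel x ^ n) $ n"
  unfolding narayana_B_poly_def narayana_kernel_power_nth lessThan_Suc_atMost poly_sum
  by (intro sum.cong) (simp_all add: poly_monom power2_eq_square flip: binomial_symmetric)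

text \<open>This is Lagrange inversion with K = 1.\<close>

lemma narayana_B_gf_compose:
  fixes x :: rat
  defines "\<phi> \<equiv> narayana_kernel x"
  shows "narayana_B_gf x = inverse (1 - fps_X * fps_deriv \<phi> * inverse \<phi>) oo narayana_gf x"
  using lagrange_inversion[of \<phi> 1]
  by (simp add: fps_eq_iff narayana_B_gf_def narayana_B_poly_Suc narayana_gf_def \<phi>_def)

lemma narayana_B_gf_eq:
  "narayana_B_gf x * (1 - fps_X * (1 + fps_const x + 2 * fps_const x * narayana_gf x)) = 1"
proof -
  let ?\<phi> = "narayana_kernel x" and ?N = "narayana_gf x"
  let ?D = "1 - fps_X * fps_deriv ?\<phi> * inverse ?\<phi>"
  have "narayana_B_gf x = inverse ?D oo ?N" by (rule narayana_B_gf_compose)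
  moreover have "(inverse ?D oo ?N) * (?D oo ?N) = 1"
    by (simp add: inverse_mult_eq_1 flip: fps_compose_mult_distrib)
  moreover have "?D oo ?N = 1 - fps_X * (1 + fps_const x + 2 * fps_const x * ?N)"
    using fps_inv_kernel(3)[of ?\<phi>] narayana_kernel_compose(2)[OF narayana_gf_0, of x]
    by (simp add: narayana_gf_def)
  ultimately show ?thesis by simp
qed

text \<open>Differentiating N = z \<phi>(N) gives N' (1 - z \<phi>'(N)) = \<phi>(N), and the bracket
  is the inverse of \<open>narayana_B_gf x\<close>.\<close>

lemma fps_deriv_narayana_gf:
  "fps_deriv (narayana_gf x) = narayana_B_gf x * ((1 + narayana_gf x) * (1 + fps_const x * narayana_gf x))"
proof -
  let ?N = "narayana_gf x" and ?B = "narayana_B_gf x"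
  let ?E = "1 - fps_X * (1 + fps_const x + 2 * fps_const x * ?N)"
  have "fps_deriv ?N = fps_deriv (fps_X * ((1 + ?N) * (1 + fps_const x * ?N)))"
    using narayana_gf_eq by metis
  then have "fps_deriv ?N * ?E = (1 + ?N) * (1 + fps_const x * ?N)"
    by (simp add: algebra_simps)
  then have "fps_deriv ?N * (?B * ?E) = ?B * ((1 + ?N) * (1 + fps_const x * ?N))"
    by (simp only: mult_ac)
  then show ?thesis by (simp add: narayana_B_gf_eq)
qed

text \<open>Lagrange inversion with K = \<phi> applies to N' and yields n [z^n] N = [z^(n-1)]
  \<phi>^n.\<close>

lemma narayana_gf_nth: "narayana_gf x $ n = poly (narayana_poly n) x"
proof (cases n)
  case 0
  then show ?thesis by (simp add: narayana_poly_def)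
next
  case (Suc m)
  let ?\<phi> = "narayana_kernel x" and ?N = "narayana_gf x"
  let ?D = "1 - fps_X * fps_deriv ?\<phi> * inverse ?\<phi>"
  have "inverse ?D oo ?N = narayana_B_gf x" by (rule narayana_B_gf_compose[symmetric])
  then have "fps_deriv ?N = (?\<phi> * inverse ?D) oo ?N"
    by (simp add: fps_deriv_narayana_gf fps_compose_mult_distrib narayana_kernel_compose)
  then have "fps_deriv ?N $ m = (?\<phi> ^ Suc m) $ m"
    using lagrange_inversion[of ?\<phi> ?\<phi> m] by (simp add: narayana_gf_def)
  then have "of_nat n * ?N $ n = (\<Sum>k\<le>m. of_nat (n choose k) * of_nat (n choose (m - k)) * x ^ k)"
    by (simp only: fps_deriv_nth Suc narayana_kernel_power_nth) simp
  also have "\<dots> = (\<Sum>k\<le>m. of_nat (n choose k) * of_nat (n choose (k + 1)) * x ^ k)"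
  proof (rule sum.cong[OF refl])
    fix k assume "k \<in> {..m}"
    then have "n choose (k + 1) = n choose (m - k)"
      using binomial_symmetric[of "k + 1" n] Suc by simp
    then show "of_nat (n choose k) * of_nat (n choose (m - k)) * x ^ k =
        of_nat (n choose k) * of_nat (n choose (k + 1)) * x ^ k" by (simp only:)
  qed
  also have "\<dots> = of_nat n * poly (narayana_poly n) x"
    using Suc by (simp add: narayana_poly_def poly_sum poly_monom sum_distrib_left lessThan_Suc_atMost mult.assoc
        del: of_nat_Suc)
  finally show ?thesis using Suc by (simp del: of_nat_Suc)
qed

text \<open>
  This is $\exp\bigl((1 - x) \sum_j B_j(x) z^j / j\bigr)$, by the differential equation below.
\<close>

definition narayana_ratio :: "rat \<Rightarrow> rat fps" where
  "narayana_ratio x = (1 + narayana_gf x) * inverse (1 + fps_const x * narayana_gf x)"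

lemma narayana_ratio_mult:
  "narayana_ratio x * (1 + fps_const x * narayana_gf x) = 1 + narayana_gf x"
  unfolding narayana_ratio_def by (simp add: mult.assoc inverse_mult_eq_1)

lemma narayana_ratio_0 [simp]: "narayana_ratio x $ 0 = 1"
  by (simp add: narayana_ratio_def)

lemma one_plus_const_narayana_gf_nonzero [simp]: "1 + fps_const x * narayana_gf x \<noteq> 0"
proof
  assume "1 + fps_const x * narayana_gf x = 0"
  then have "(1 + fps_const x * narayana_gf x) $ 0 = 0" by simp
  then show False by simp
qed

text \<open>Differentiate G U = 1 + N with U = 1 + x N and multiply by U once more. Then U - x (1 +
  N) = 1 - x and N' = B G U^2, so U^2 cancels.\<close>

lemma fps_deriv_narayana_ratio:
  "fps_deriv (narayana_ratio x) = fps_const (1 - x) * narayana_B_gf x * narayana_ratio x"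
proof -
  let ?N = "narayana_gf x" and ?B = "narayana_B_gf x" and ?G = "narayana_ratio x" and ?c = "fps_const x"
  define U where "U = 1 + ?c * ?N"
  have U: "U \<noteq> 0" by (simp add: U_def)
  have GU: "?G * U = 1 + ?N" by (simp add: U_def narayana_ratio_mult)
  have "fps_deriv (?G * U) = fps_deriv (1 + ?N)" by (simp only: GU)
  then have d: "fps_deriv ?G * U = fps_deriv ?N - ?G * ?c * fps_deriv ?N"
    by (simp add: U_def algebra_simps)
  have "fps_deriv ?G * U * U = fps_deriv ?N * (U - ?c * (?G * U))"
    unfolding d by (simp only: algebra_simps)
  also have "\<dots> = (1 - ?c) * fps_deriv ?N"
    unfolding GU by (simp add: U_def algebra_simps)
  also have "fps_deriv ?N = ?B * ((?G * U) * U)"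
    unfolding GU by (simp add: U_def fps_deriv_narayana_gf)
  also have "(1 - ?c) * \<dots> = (1 - ?c) * ?B * ?G * U * U" by (simp only: mult_ac)
  finally have "fps_deriv ?G = (1 - ?c) * ?B * ?G" using U by simp
  then show ?thesis by (simp flip: fps_const_sub)
qed

section \<open>Bivariate series\<close>

text \<open>
  Multiplying $(z - w) Q$ by $(1 + x N)(1 + x M)$ turns it into $N - M$; the kernel equations do
  the same to $(z - w)(1 + N)(1 + M)$ up to the factor $1 - x N M$.
\<close>

lemma hankel_kernel_identity:
  fixes x z w N M Q a b :: "'a :: idom"
  assumes N: "N = z * ((1 + N) * (1 + x * N))" and M: "M = w * ((1 + M) * (1 + x * M))"
    and Q: "(z - w) * Q = z * (1 + N) - w * (1 + M)"
    and a: "a * (1 + x * N) = 1 + N" and b: "b * (1 + x * M) = 1 + M"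
    and nz: "z \<noteq> w" "1 + x * N \<noteq> 0" "1 + x * M \<noteq> 0"
  shows "Q * (1 - x * a * b) = (1 - x) * a * b"
proof -
  define U V where "U = 1 + x * N" and "V = 1 + x * M"
  have N': "z * (1 + N) * U = N" and M': "w * (1 + M) * V = M"
    using N M by (simp_all add: U_def V_def mult.assoc)
  have "(z - w) * Q * (U * V) = (z * (1 + N) * U) * V - (w * (1 + M) * V) * U"
    unfolding Q by (simp only: algebra_simps)
  also have "\<dots> = N - M" unfolding N' M' by (simp add: U_def V_def algebra_simps)
  finally have 1: "(z - w) * Q * (U * V) = N - M" .
  have "(z - w) * ((1 + N) * (1 + M)) * (U * V) =
      (z * (1 + N) * U) * (1 + M) * V - (w * (1 + M) * V) * (1 + N) * U"
    by (simp only: algebra_simps)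
  also have "\<dots> = (N - M) * (1 - x * N * M)"
    unfolding N' M' by (simp add: U_def V_def algebra_simps)
  also have "\<dots> = (z - w) * (Q * (1 - x * N * M)) * (U * V)"
    unfolding 1[symmetric] by (simp only: mult_ac)
  finally have 2: "Q * (1 - x * N * M) = (1 + N) * (1 + M)"
    using nz by (simp add: U_def V_def)
  \<comment> \<open>Here a U = 1 + N and b V = 1 + M, and U V - x (1 + N)(1 + M) factors as (1 -
    x)(1 - x N M).\<close>
  have "Q * (1 - x * a * b) * (U * V) = Q * (U * V - x * (a * U) * (b * V))"
    by (simp only: algebra_simps mult_1_left)
  also have "\<dots> = (1 - x) * (Q * (1 - x * N * M))"
    unfolding a[folded U_def] b[folded V_def] by (simp add: U_def V_def algebra_simps)
  also have "\<dots> = (1 - x) * a * b * (U * V)"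
    unfolding 2 a[folded U_def, symmetric] b[folded V_def, symmetric] by (simp only: mult_ac)
  finally show ?thesis using nz by (simp add: U_def V_def)
qed

text \<open>
  A bivariate series in $z, w$ is a series in $z$ whose coefficients are series in $w$. Thus $w$
  is \<open>fps_const fps_X\<close>, a series in $w$ is embedded by \<open>fps_const\<close>, and one in $z$ by the
  following map.
\<close>

definition fps_outer :: "'a :: comm_ring_1 fps \<Rightarrow> 'a fps fps" where
  "fps_outer f = Abs_fps (\<lambda>n. fps_const (f $ n))"

lemma fps_outer_mult: "fps_outer (f * g) = fps_outer f * fps_outer g"
proof (rule fps_ext)
  fix n
  have "fps_const (\<Sum>i\<in>A. h i) = (\<Sum>i\<in>A. fps_const (h i :: 'a))" for h and A :: "nat set"
    by (induction A rule: infinite_finite_induct) (simp_all flip: fps_const_add)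
  then show "fps_outer (f * g) $ n = (fps_outer f * fps_outer g) $ n"
    by (simp add: fps_outer_def fps_mult_nth)
qed

lemma fps_outer_add: "fps_outer (f + g) = fps_outer f + fps_outer g"
  by (simp add: fps_outer_def fps_eq_iff)

lemma fps_outer_1: "fps_outer 1 = 1"
  by (simp add: fps_outer_def fps_eq_iff)

lemma fps_outer_X: "fps_outer fps_X = fps_X"
  by (simp add: fps_outer_def fps_eq_iff fps_X_def)

lemma fps_outer_const: "fps_outer (fps_const c) = fps_const (fps_const c)"
  by (simp add: fps_outer_def fps_eq_iff)

lemmas fps_outer_simps = fps_outer_mult fps_outer_add fps_outer_1 fps_outer_X fps_outer_const

lemma fps_outer_times_const_nth:
  "(fps_outer f * fps_const g) $ n $ k = f $ n * g $ k"
  by (simp add: fps_outer_def)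

lemma fps_times_outer_times_const_nth:
  "(Q * fps_outer f * fps_const g) $ n $ k = (\<Sum>i\<le>n. \<Sum>j\<le>k. Q $ i $ j * f $ (n - i) * g $ (k - j))"
proof -
  have "(fps_outer f * fps_const g) $ m = fps_const (f $ m) * g" for m
    by (simp add: fps_outer_def)
  then have "(Q * fps_outer f * fps_const g) $ n = (\<Sum>i\<le>n. Q $ i * (fps_const (f $ (n - i)) * g))"
    by (simp only: mult.assoc fps_mult_nth[of Q] atMost_atLeast0)
  then show ?thesis
    by (simp add: fps_sum_nth fps_mult_nth[of "Q $ i" for i] atMost_atLeast0 mult.assoc)
qed

text \<open>By the next lemma this is the divided difference (z f(z) - w f(w)) / (z - w).\<close>

definition fps_hankel :: "'a :: comm_ring_1 fps \<Rightarrow> 'a fps fps" where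
  "fps_hankel f = Abs_fps (\<lambda>n. Abs_fps (\<lambda>k. f $ (n + k)))"

text \<open>At z^n w^k with n, k > 0 the two shifts both give \<open>f $ (n + k - 1)\<close> and
  cancel; only the terms with n = 0 or k = 0 survive.\<close>

lemma fps_hankel_eq:
  "(fps_X - fps_const fps_X) * fps_hankel f = fps_X * fps_outer f - fps_const fps_X * fps_const f"
proof (intro fps_ext)
  fix n k
  show "((fps_X - fps_const fps_X) * fps_hankel f) $ n $ k =
    (fps_X * fps_outer f - fps_const fps_X * fps_const f) $ n $ k"
    by (cases n; cases k) (simp_all add: left_diff_distrib fps_hankel_def fps_outer_def)
qed

section \<open>The product formula\<close>

lemma narayana_B_perm_poly_eq_prod:
  "narayana_B_perm_poly n w = (\<Prod>c\<in>perm_cycles n w. narayana_B_poly (card c))"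
  by (simp add: narayana_B_perm_poly_def perm_cycle_type_def prod_unfold_prod_mset multiset.map_comp o_def)

text \<open>The polynomial P_n(y) of the overview, with x fixed to a number.\<close>

definition cycle_poly :: "rat \<Rightarrow> nat \<Rightarrow> rat poly" where
  "cycle_poly x n = smult (1 / fact n)
    (\<Sum>w\<in>sym_group n. monom (poly (narayana_B_perm_poly n w) x) (num_cycles n w))"

text \<open>The logarithmic derivative of G^t is t (1 - x) B. The exponential formula turns its
  constant factor into one factor (1 - x) t per cycle.\<close>

lemma poly_cycle_poly:
  "poly (cycle_poly x n) ((1 - x) * of_nat t) = (narayana_ratio x ^ t) $ n"
proof -
  define F where "F = of_nat t * (fps_const (1 - x) * narayana_B_gf x)"
  have "fps_deriv (narayana_ratio x ^ t) = F * narayana_ratio x ^ t"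
  proof (cases t)
    case (Suc s)
    show ?thesis
      unfolding fps_deriv_power'[of _ t] fps_deriv_narayana_ratio F_def
      by (simp only: Suc diff_Suc_1 power_Suc mult_ac)
  qed (simp add: F_def)
  moreover have "(narayana_ratio x ^ t) $ 0 = 1" by (simp add: fps_power_zeroth)
  ultimately have "(\<Sum>w\<in>sym_group n. \<Prod>c\<in>perm_cycles n w. F $ (card c - 1)) =
      fact n * (narayana_ratio x ^ t) $ n"
    by (rule exponential_formula_cycles)
  moreover have "(\<Prod>c\<in>perm_cycles n w. F $ (card c - 1)) =
      poly (narayana_B_perm_poly n w) x * ((1 - x) * of_nat t) ^ num_cycles n w"
    if w: "w \<in> sym_group n" for w
  proof -
    have "F $ (card c - 1) = ((1 - x) * of_nat t) * poly (narayana_B_poly (card c)) x"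
      if "c \<in> perm_cycles n w" for c
      using card_perm_cycle_pos[OF w that] by (simp add: F_def narayana_B_gf_def)
    then show ?thesis
      by (simp add: narayana_B_perm_poly_eq_prod poly_prod num_cycles_def prod.distrib)
  qed
  ultimately have "(\<Sum>w\<in>sym_group n. poly (narayana_B_perm_poly n w) x * ((1 - x) * of_nat t) ^ num_cycles n w) =
      fact n * (narayana_ratio x ^ t) $ n" by simp
  then show ?thesis by (simp add: cycle_poly_def poly_sum poly_monom)
qed

lemma poly_eqI_infinite:
  fixes p q :: "'a :: idom poly"
  assumes "infinite A" and "\<And>y. y \<in> A \<Longrightarrow> poly p y = poly q y"
  shows "p = q"
proof (rule ccontr)
  assume "p \<noteq> q"
  then have "finite {y. poly (p - q) y = 0}" by (intro poly_roots_finite) simp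
  moreover have "A \<subseteq> {y. poly (p - q) y = 0}" using assms(2) by auto
  ultimately show False using assms(1) finite_subset by blast
qed

text \<open>Both sides are polynomials in $y$ that agree at the infinitely many points $y = (1 - x) t$.\<close>

lemma cycle_poly_shift:
  assumes "x \<noteq> 1"
  shows "pcompose (cycle_poly x n) [:1 - x, 1:] =
    (\<Sum>i\<le>n. smult (narayana_ratio x $ (n - i)) (cycle_poly x i))"
proof (rule poly_eqI_infinite)
  show "infinite (range (\<lambda>t. (1 - x) * of_nat t :: rat))"
    using assms by (intro range_inj_infinite) (auto simp: inj_def)
  fix y assume "y \<in> range (\<lambda>t. (1 - x) * of_nat t :: rat)"
  then obtain t where y: "y = (1 - x) * of_nat t" by auto
  \<comment> \<open>The shift by 1 - x raises t by one, so G^t gains a factor G and the coefficient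
    becomes a Cauchy product.\<close>
  have "1 - x + y = (1 - x) * of_nat (Suc t)" by (simp add: y algebra_simps)
  then have "poly (pcompose (cycle_poly x n) [:1 - x, 1:]) y = (narayana_ratio x ^ t * narayana_ratio x) $ n"
    using poly_cycle_poly[of x n "Suc t"] by (simp add: poly_pcompose mult.commute)
  also have "\<dots> = (\<Sum>i\<le>n. narayana_ratio x $ (n - i) * poly (cycle_poly x i) y)"
    unfolding y poly_cycle_poly fps_mult_nth by (simp add: atMost_atLeast0 mult.commute)
  finally show "poly (pcompose (cycle_poly x n) [:1 - x, 1:]) y =
      poly (\<Sum>i\<le>n. smult (narayana_ratio x $ (n - i)) (cycle_poly x i)) y"
    by (simp add: poly_sum)
qed

text \<open>The series of the left-hand values and the Hankel series of 1 + N solve the same linear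
  equation, whose coefficient has constant term 1 - x and can be cancelled. The summand 1 accounts
  for n = k = 0, where the left side is E_0 = 1 but N has constant term 0.\<close>

lemma eulerian_functional_cycle_poly_mult:
  assumes x: "x \<noteq> 1"
  shows "eulerian_functional x (cycle_poly x n * cycle_poly x k) = (1 + narayana_gf x) $ (n + k)"
proof -
  define L where "L i j = eulerian_functional x (cycle_poly x i * cycle_poly x j)" for i j
  define G where "G = narayana_ratio x"
  define Lam where "Lam = Abs_fps (\<lambda>i. Abs_fps (L i))"
  define c where "c = fps_const (fps_const x)"
  let ?N = "narayana_gf x"
  have rec: "L n k - x * (\<Sum>i\<le>n. \<Sum>j\<le>k. L i j * G $ (n - i) * G $ (k - j)) = (1 - x) * (G $ n * G $ k)" for n k
  proof -
    let ?p = "cycle_poly x n * cycle_poly x k"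
    have "pcompose ?p [:1 - x, 1:] =
        (\<Sum>i\<le>n. \<Sum>j\<le>k. smult (G $ (n - i) * G $ (k - j)) (cycle_poly x i * cycle_poly x j))"
      unfolding pcompose_mult cycle_poly_shift[OF x] sum_product G_def by (simp add: mult_ac)
    then have "eulerian_functional x (pcompose ?p [:1 - x, 1:]) =
        (\<Sum>i\<le>n. \<Sum>j\<le>k. L i j * G $ (n - i) * G $ (k - j))"
      by (simp add: eulerian_functional_sum eulerian_functional_smult L_def mult_ac)
    \<comment> \<open>The point 1 - x is the case t = 1 of \<open>poly_cycle_poly\<close>.\<close>
    moreover have "poly ?p (1 - x) = G $ n * G $ k"
      using poly_cycle_poly[of x _ 1] by (simp add: G_def)
    ultimately show ?thesis
      using eulerian_functional_shift[of x ?p] by (simp add: L_def)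
  qed
  have Lam: "Lam * (1 - c * fps_outer G * fps_const G) = (1 - c) * fps_outer G * fps_const G"
  proof (intro fps_ext)
    fix n k
    have "(Lam * (1 - c * fps_outer G * fps_const G)) $ n $ k =
        (Lam - c * (Lam * fps_outer G * fps_const G)) $ n $ k" by (simp only: algebra_simps mult_1_right mult_1_left)
    also have "\<dots> = L n k - x * (\<Sum>i\<le>n. \<Sum>j\<le>k. L i j * G $ (n - i) * G $ (k - j))"
      unfolding fps_sub_nth c_def fps_mult_left_const_nth fps_times_outer_times_const_nth
      by (simp add: Lam_def)
    also have "\<dots> = (1 - x) * (fps_outer G * fps_const G) $ n $ k"
      unfolding rec fps_outer_times_const_nth ..
    also have "\<dots> = (fps_const (fps_const (1 - x)) * (fps_outer G * fps_const G)) $ n $ k"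
      unfolding fps_mult_left_const_nth ..
    also have "fps_const (fps_const (1 - x)) = 1 - c"
      by (simp add: c_def flip: fps_const_sub)
    finally show "(Lam * (1 - c * fps_outer G * fps_const G)) $ n $ k = ((1 - c) * fps_outer G * fps_const G) $ n $ k"
      by (simp only: mult.assoc)
  qed
  have nonzero: "f \<noteq> 0" if "f $ 0 $ 0 \<noteq> 0" for f :: "rat fps fps"
    using that by auto
  have Hankel: "fps_hankel (1 + ?N) * (1 - c * fps_outer G * fps_const G) = (1 - c) * fps_outer G * fps_const G"
  proof (rule hankel_kernel_identity)
    show "fps_outer ?N = fps_X * ((1 + fps_outer ?N) * (1 + c * fps_outer ?N))"
      using arg_cong[OF narayana_gf_eq[of x], of fps_outer] unfolding c_def by (simp only: fps_outer_simps)
    show "fps_const ?N = fps_const fps_X * ((1 + fps_const ?N) * (1 + c * fps_const ?N))"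
      using arg_cong[OF narayana_gf_eq[of x], of fps_const] unfolding c_def
      by (simp only: fps_const_mult[symmetric] fps_const_add[symmetric] fps_const_1_eq_1)
    show "(fps_X - fps_const fps_X) * fps_hankel (1 + ?N) =
        fps_X * (1 + fps_outer ?N) - fps_const fps_X * (1 + fps_const ?N)"
      unfolding fps_hankel_eq by (simp only: fps_outer_simps fps_const_add[symmetric] fps_const_1_eq_1)
    show "fps_outer G * (1 + c * fps_outer ?N) = 1 + fps_outer ?N"
      using arg_cong[OF narayana_ratio_mult[of x], of fps_outer] unfolding c_def G_def by (simp only: fps_outer_simps)
    show "fps_const G * (1 + c * fps_const ?N) = 1 + fps_const ?N"
      using arg_cong[OF narayana_ratio_mult[of x], of fps_const] unfolding c_def G_def
      by (simp only: fps_const_mult[symmetric] fps_const_add[symmetric] fps_const_1_eq_1)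
    show "fps_X \<noteq> fps_const (fps_X :: rat fps)"
    proof
      assume "fps_X = fps_const (fps_X :: rat fps)"
      then have "fps_X $ 0 = fps_const (fps_X :: rat fps) $ 0" by (rule arg_cong)
      then show False by simp
    qed
    have "(1 + c * fps_outer ?N) $ 0 $ 0 = 1" "(1 + c * fps_const ?N) $ 0 $ 0 = 1"
      by (simp_all add: c_def fps_outer_def)
    then show "1 + c * fps_outer ?N \<noteq> 0" "1 + c * fps_const ?N \<noteq> 0"
      by (intro nonzero; simp only: one_neq_zero not_False_eq_True)+
  qed
  have "(1 - c * fps_outer G * fps_const G) $ 0 $ 0 = 1 - x"
    by (simp add: c_def fps_outer_def G_def)
  then have "1 - c * fps_outer G * fps_const G \<noteq> 0" using x by (intro nonzero) simp
  then have "Lam = fps_hankel (1 + ?N)" using Lam Hankel by (metis mult_right_cancel)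
  then have "Lam $ n $ k = fps_hankel (1 + ?N) $ n $ k" by simp
  then show ?thesis by (simp only: Lam_def fps_hankel_def fps_nth_Abs_fps L_def)
qed

theorem corollary5p5:
  fixes n k :: nat
  assumes "n \<ge> 1" and "k \<ge> 1"
  shows "narayana_poly (n + k) =
    smult (1 / (fact n * fact k))
      (\<Sum>\<pi>\<in>sym_group n. \<Sum>\<sigma>\<in>sym_group k.
         narayana_B_perm_poly n \<pi> * narayana_B_perm_poly k \<sigma> *
         eulerian_poly (num_cycles n \<pi> + num_cycles k \<sigma>))"
\<comment> \<open>The rationals other than 1 are infinitely many, so the excluded value costs
  nothing.\<close>
proof (rule poly_eqI_infinite)
  show "infinite (UNIV - {1 :: rat})" by (simp add: infinite_UNIV_char_0)
  fix x :: rat assume "x \<in> UNIV - {1}"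
  then have x: "x \<noteq> 1" by simp
  \<comment> \<open>The added 1 affects only index 0, and n + k is positive.\<close>
  have "poly (narayana_poly (n + k)) x = (1 + narayana_gf x) $ (n + k)"
    using assms by (simp add: narayana_gf_nth)
  also have "\<dots> = eulerian_functional x (cycle_poly x n * cycle_poly x k)"
    by (rule eulerian_functional_cycle_poly_mult[OF x, symmetric])
  \<comment> \<open>Multiplying the monomials adds the cycle numbers, so the functional produces the
    Eulerian polynomial of their sum.\<close>
  also have "cycle_poly x n * cycle_poly x k = smult (1 / (fact n * fact k))
      (\<Sum>\<pi>\<in>sym_group n. \<Sum>\<sigma>\<in>sym_group k.
        monom (poly (narayana_B_perm_poly n \<pi>) x * poly (narayana_B_perm_poly k \<sigma>) x)
          (num_cycles n \<pi> + num_cycles k \<sigma>))"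
    unfolding cycle_poly_def mult_smult_left mult_smult_right smult_smult sum_product mult_monom
    by (simp add: mult.commute)
  finally show "poly (narayana_poly (n + k)) x = poly (smult (1 / (fact n * fact k))
      (\<Sum>\<pi>\<in>sym_group n. \<Sum>\<sigma>\<in>sym_group k.
         narayana_B_perm_poly n \<pi> * narayana_B_perm_poly k \<sigma> *
         eulerian_poly (num_cycles n \<pi> + num_cycles k \<sigma>))) x"
    by (simp add: eulerian_functional_smult eulerian_functional_sum eulerian_functional_monom poly_sum)
qed

end
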